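(* Let $G$ be any abelian-by-(nilpotent of class $2$) group generated by two mutually Engel elements $x$ and $y$. Then $G$ is nilpotent.
   Context: Commutator notation: $[x,y]=x^{-1}y^{-1}xy$, and $[x,\,_0 y]=x$, $[x,\,_{n+1}y]=[[x,\,_n y],y]$ for $n\ge 0$. Elements $x$ and $y$ of a group are called mutually Engel if there are positive integers $n,m$ such that $[x,\,_n y]=1$ and $[y,\,_m x]=1$. A group $G$ is abelian-by-(nilpotent of class $2$) if it has an abelian normal subgroup $A$ such that $G/A$ is nilpotent of class at most $2$. The group $G$ is not assumed to be finite. *)

theory Defs
  imports "HOL-Algebra.Algebra"
begin

(* The library's derived_set uses the convention h1 h2 h1^-1 h2^-1; here [x, y] = x^-1 y^-1 x y. *)
definition commutator :: "('a, 'b) monoid_scheme \<Rightarrow> 'a \<Rightarrow> 'a \<Rightarrow> 'a" where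
  "commutator G x y = inv\<^bsub>G\<^esub> x \<otimes>\<^bsub>G\<^esub> inv\<^bsub>G\<^esub> y \<otimes>\<^bsub>G\<^esub> x \<otimes>\<^bsub>G\<^esub> y"

primrec iter_commutator :: "('a, 'b) monoid_scheme \<Rightarrow> 'a \<Rightarrow> nat \<Rightarrow> 'a \<Rightarrow> 'a" where
  "iter_commutator G x 0 y = x"
| "iter_commutator G x (Suc n) y = commutator G (iter_commutator G x n y) y"

definition mutually_engel :: "('a, 'b) monoid_scheme \<Rightarrow> 'a \<Rightarrow> 'a \<Rightarrow> bool" where
  "mutually_engel G x y \<longleftrightarrow>
     (\<exists>n m. n > 0 \<and> m > 0 \<and> iter_commutator G x n y = \<one>\<^bsub>G\<^esub> \<and> iter_commutator G y m x = \<one>\<^bsub>G\<^esub>)"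

(* Indexed from 0: lower_central G n is the term usually written gamma_(n+1)(G). *)
primrec lower_central :: "('a, 'b) monoid_scheme \<Rightarrow> nat \<Rightarrow> 'a set" where
  "lower_central G 0 = carrier G"
| "lower_central G (Suc n) =
     generate G {commutator G a b | a b. a \<in> lower_central G n \<and> b \<in> carrier G}"

definition nilpotent_class_le :: "nat \<Rightarrow> ('a, 'b) monoid_scheme \<Rightarrow> bool" where
  "nilpotent_class_le c G \<longleftrightarrow> group G \<and> lower_central G c = {\<one>\<^bsub>G\<^esub>}"

definition nilpotent_group :: "('a, 'b) monoid_scheme \<Rightarrow> bool" where
  "nilpotent_group G \<longleftrightarrow> (\<exists>c. nilpotent_class_le c G)"

definition abelian_by_nilpotent2 :: "('a, 'b) monoid_scheme \<Rightarrow> bool" where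
  "abelian_by_nilpotent2 G \<longleftrightarrow>
     (\<exists>A. A \<lhd> G \<and> comm_group (G\<lparr>carrier := A\<rparr>) \<and> nilpotent_class_le 2 (G Mod A))"

end

theory Submission
  imports Defs
begin

text \<open>
  Let \<open>A\<close> be the abelian normal subgroup, and put \<open>c = [x, y]\<close>, \<open>u = [c, x]\<close>, \<open>v = [c, y]\<close>. Since
  \<open>G/A\<close> has class at most 2, \<open>u\<close> and \<open>v\<close> lie in \<open>A\<close>. It is enough that they lie in some term of the
  upper central series: modulo that term \<open>c\<close> commutes with both generators, so one term further
  up contains \<open>c\<close>, and the next one contains \<open>x\<close> and \<open>y\<close>.

  Conjugation by \<open>x\<close>, \<open>y\<close>, \<open>c\<close> gives three operators \<open>\<xi>\<close>, \<open>\<eta>\<close>, \<open>\<zeta>\<close> on \<open>A\<close>, and \<open>\<zeta>\<close> commutes with the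
  other two because \<open>[c, x]\<close> and \<open>[c, y]\<close> act trivially on \<open>A\<close>. Written on the right and additively,
  \<open>\<xi>\<eta> = \<eta>\<xi>\<zeta>\<close>, so that \<open>A\<close> is a module over the integral Heisenberg group. The Engel conditions say
  that \<open>u(\<xi> - 1)\<^sup>k = 0\<close> and \<open>v(\<eta> - 1)\<^sup>m = 0\<close>, and expanding the conjugate of \<open>c\<close> by \<open>xy = yxc\<close> in
  two ways gives \<open>u(\<eta> - \<zeta>) = v(\<xi>\<zeta> - 1)\<close>. These equations force
  \<open>u\<close> and \<open>v\<close> to be hypercentral, for the following reason.

  Otherwise, by Zorn's lemma, there is a submodule \<open>K\<close> that is maximal among the submodules that
  contain the hypercentral elements, do not contain both \<open>u\<close> and \<open>v\<close>, and whose quotient has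
  no nonzero vector fixed by \<open>\<xi>\<close> and \<open>\<eta>\<close>. Maximality
  makes \<open>K\<close> prime: an operator that is central modulo \<open>K\<close> is either zero or injective modulo \<open>K\<close>
  (lemma \<open>isolated_preimage\<close> and theorem \<open>engel_generators_mem\<close>). So \<open>\<zeta>\<close> behaves like a scalar, and
  there are three cases.

  If \<open>\<zeta> = 1\<close>, then \<open>\<xi> - 1\<close> and \<open>\<eta> - 1\<close> are central. An injective one would put a generator, and then
  by the relation the other, into \<open>K\<close>; if both are zero, everything is fixed
  (\<open>both_mem_if_zeta_trivial\<close>).

  If \<open>\<zeta>\<close> has infinite order, \<open>v\<close> is annihilated by a product of factors \<open>\<xi>\<zeta>\<^sup>i - 1\<close>, and
  applying \<open>\<eta>\<close> raises the exponents \<open>i\<close> by one. A vector that is also unipotent for \<open>\<eta>\<close> can be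
  compared with its translates until the exponents are disjoint, and a vector with two disjoint
  sets of eigenvalues is zero (\<open>mem_if_eta_unipotent\<close>).

  If \<open>\<zeta>\<close> has finite order \<open>l \<ge> 2\<close>, exponents wrap around, but for the same reason the full product of
  \<open>\<xi>\<zeta>\<^sup>i - 1\<close> over all residues \<open>i\<close> is central, and hence zero. This makes \<open>\<xi>\<close> semisimple on
  \<open>u\<close> and \<open>v\<close>, and the relation then forces \<open>u = v = 0\<close> (\<open>both_mem_if_zeta_order\<close>).
\<close>

section \<open>The upper central series\<close>

primrec upper_central :: "('a, 'b) monoid_scheme \<Rightarrow> nat \<Rightarrow> 'a set" where
  "upper_central G 0 = {\<one>\<^bsub>G\<^esub>}"
| "upper_central G (Suc n) = {g \<in> carrier G. \<forall>h\<in>carrier G. commutator G g h \<in> upper_central G n}"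

definition hypercenter :: "('a, 'b) monoid_scheme \<Rightarrow> 'a set" where
  "hypercenter G = (\<Union>n. upper_central G n)"

context group
begin

lemma cancel_inv_left: "a \<in> carrier G \<Longrightarrow> b \<in> carrier G \<Longrightarrow> inv a \<otimes> (a \<otimes> b) = b"
  and cancel_inv_right: "a \<in> carrier G \<Longrightarrow> b \<in> carrier G \<Longrightarrow> a \<otimes> (inv a \<otimes> b) = b"
  by (simp_all flip: m_assoc)

text \<open>As rewrite rules these decide the word problem in free groups, so they prove every commutator
  identity that holds in all groups.\<close>
lemmas word_simps = m_assoc inv_mult_group cancel_inv_left cancel_inv_right

lemma commutator_closed [simp]: "a \<in> carrier G \<Longrightarrow> b \<in> carrier G \<Longrightarrow> commutator G a b \<in> carrier G"
  by (simp add: commutator_def)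

lemma normal_conj: "N \<lhd> G \<Longrightarrow> g \<in> carrier G \<Longrightarrow> a \<in> N \<Longrightarrow> g \<otimes> a \<otimes> inv g \<in> N"
  by (simp add: normal_inv_iff)

lemma normal_conj': "N \<lhd> G \<Longrightarrow> g \<in> carrier G \<Longrightarrow> a \<in> N \<Longrightarrow> inv g \<otimes> a \<otimes> g \<in> N"
  using normal_conj[of N "inv g" a] by simp

text \<open>Centrality modulo \<open>N\<close> can therefore be tested on a generating set.\<close>
lemma subgroup_centralizer_modulo:
  assumes N: "N \<lhd> G" and a: "a \<in> carrier G"
  shows "subgroup {h \<in> carrier G. commutator G a h \<in> N} G"
proof -
  interpret N: normal N G by (rule N)
  show ?thesis
  proof (rule subgroupI)
    have "commutator G a \<one> = \<one>"
      using a by (simp add: commutator_def)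
    then show "{h \<in> carrier G. commutator G a h \<in> N} \<noteq> {}"
      by (metis (mono_tags) N.one_closed empty_Collect_eq one_closed)
  next
    fix h assume h: "h \<in> {h \<in> carrier G. commutator G a h \<in> N}"
    then have "commutator G a (inv h) = h \<otimes> inv (commutator G a h) \<otimes> inv h"
      using a by (simp add: commutator_def word_simps)
    then show "inv h \<in> {h \<in> carrier G. commutator G a h \<in> N}"
      using h normal_conj[OF N] by simp
  next
    fix h k assume hk: "h \<in> {h \<in> carrier G. commutator G a h \<in> N}" "k \<in> {h \<in> carrier G. commutator G a h \<in> N}"
    then have "commutator G a (h \<otimes> k) = commutator G a k \<otimes> (inv k \<otimes> commutator G a h \<otimes> k)"
      using a by (simp add: commutator_def word_simps)
    then show "h \<otimes> k \<in> {h \<in> carrier G. commutator G a h \<in> N}"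
      using hk normal_conj'[OF N] by simp
  qed auto
qed

lemma upper_central_normal: "upper_central G n \<lhd> G"
proof (induction n)
  case 0
  show ?case
    by (simp add: one_is_normal)
next
  case (Suc n)
  interpret N: normal "upper_central G n" G by (rule Suc)
  have "subgroup (upper_central G (Suc n)) G"
  proof (rule subgroupI)
    have "commutator G \<one> h = \<one>" if "h \<in> carrier G" for h
      using that by (simp add: commutator_def)
    then have "\<one> \<in> upper_central G (Suc n)"
      by simp
    then show "upper_central G (Suc n) \<noteq> {}"
      by blast
  next
    fix a assume a: "a \<in> upper_central G (Suc n)"
    then have "commutator G (inv a) h = a \<otimes> inv (commutator G a h) \<otimes> inv a" if "h \<in> carrier G" for h
      using that by (simp add: commutator_def word_simps)
    then show "inv a \<in> upper_central G (Suc n)"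
      using a normal_conj[OF Suc] by simp
  next
    fix a b assume ab: "a \<in> upper_central G (Suc n)" "b \<in> upper_central G (Suc n)"
    then have "commutator G (a \<otimes> b) h = (inv b \<otimes> commutator G a h \<otimes> b) \<otimes> commutator G b h"
      if "h \<in> carrier G" for h
      using that by (simp add: commutator_def word_simps)
    then show "a \<otimes> b \<in> upper_central G (Suc n)"
      using ab normal_conj'[OF Suc] by simp
  qed auto
  moreover have "g \<otimes> a \<otimes> inv g \<in> upper_central G (Suc n)"
    if "g \<in> carrier G" "a \<in> upper_central G (Suc n)" for g a
  proof -
    have "commutator G (g \<otimes> a \<otimes> inv g) h = g \<otimes> commutator G a (inv g \<otimes> h \<otimes> g) \<otimes> inv g"
      if "h \<in> carrier G" for h
      using that \<open>g \<in> carrier G\<close> \<open>a \<in> upper_central G (Suc n)\<close> by (simp add: commutator_def word_simps)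
    then show ?thesis
      using that normal_conj[OF Suc] by simp
  qed
  ultimately show ?case
    by (simp only: normal_inv_iff) blast
qed

lemma upper_central_subset: "upper_central G n \<subseteq> carrier G"
  using upper_central_normal normal_imp_subgroup subgroup.subset by blast

lemma upper_central_Suc: "upper_central G n \<subseteq> upper_central G (Suc n)"
proof
  fix a assume a: "a \<in> upper_central G n"
  interpret N: normal "upper_central G n" G by (rule upper_central_normal)
  have "commutator G a h \<in> upper_central G n" if h: "h \<in> carrier G" for h
  proof -
    have "commutator G a h = inv a \<otimes> (inv h \<otimes> a \<otimes> h)"
      using h a by (simp add: commutator_def m_assoc)
    then show ?thesis
      using normal_conj'[OF upper_central_normal h a] a by simp
  qed
  then show "a \<in> upper_central G (Suc n)"
    using a by simp
qed

lemma upper_central_mono: "n \<le> m \<Longrightarrow> upper_central G n \<subseteq> upper_central G m"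
  by (rule lift_Suc_mono_le[of "upper_central G"]) (use upper_central_Suc in auto)

lemma hypercenter_subgroup: "subgroup (hypercenter G) G"
proof (rule subgroupI)
  show "hypercenter G \<subseteq> carrier G"
    using upper_central_subset by (auto simp: hypercenter_def)
  show "hypercenter G \<noteq> {}"
    by (auto simp: hypercenter_def intro: exI[of _ 0])
  fix a b assume "a \<in> hypercenter G" "b \<in> hypercenter G"
  then obtain i j where "a \<in> upper_central G i" "b \<in> upper_central G j"
    by (auto simp: hypercenter_def)
  then have ab: "a \<in> upper_central G (max i j)" "b \<in> upper_central G (max i j)"
    using upper_central_mono[of i "max i j"] upper_central_mono[of j "max i j"] by auto
  interpret N: normal "upper_central G (max i j)" G by (rule upper_central_normal)
  show "a \<otimes> b \<in> hypercenter G"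
    using ab N.m_closed by (auto simp only: hypercenter_def)
next
  fix a assume "a \<in> hypercenter G"
  then obtain i where a: "a \<in> upper_central G i"
    by (auto simp: hypercenter_def)
  interpret N: normal "upper_central G i" G by (rule upper_central_normal)
  show "inv a \<in> hypercenter G"
    using a N.m_inv_closed by (auto simp only: hypercenter_def)
qed

lemma hypercenter_conj:
  assumes "g \<in> carrier G" "a \<in> carrier G"
  shows "inv g \<otimes> a \<otimes> g \<in> hypercenter G \<longleftrightarrow> a \<in> hypercenter G"
proof
  assume "inv g \<otimes> a \<otimes> g \<in> hypercenter G"
  then have "g \<otimes> (inv g \<otimes> a \<otimes> g) \<otimes> inv g \<in> hypercenter G"
    using normal_conj[OF upper_central_normal assms(1)] by (auto simp only: hypercenter_def)
  then show "a \<in> hypercenter G"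
    using assms by (simp add: word_simps)
next
  assume "a \<in> hypercenter G"
  then show "inv g \<otimes> a \<otimes> g \<in> hypercenter G"
    using normal_conj'[OF upper_central_normal assms(1)] by (auto simp only: hypercenter_def)
qed

text \<open>Finiteness of \<open>S\<close> provides one term of the upper central series that contains all the
  commutators with generators.\<close>
lemma hypercenter_generators:
  assumes S: "S \<subseteq> carrier G" "finite S" and gen: "generate G S = carrier G" and a: "a \<in> carrier G"
    and comm: "\<And>s. s \<in> S \<Longrightarrow> commutator G a s \<in> hypercenter G"
  shows "a \<in> hypercenter G"
proof -
  obtain n where "\<forall>s\<in>S. commutator G a s \<in> upper_central G n"
    using S(2) comm
  proof (induction S arbitrary: thesis)
    case (insert s S)
    obtain n where n: "\<forall>s\<in>S. commutator G a s \<in> upper_central G n"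
      using insert by auto
    obtain m where m: "commutator G a s \<in> upper_central G m"
      using insert.prems(2)[of s] by (auto simp: hypercenter_def)
    show ?case
      using upper_central_mono[of n "max n m"] upper_central_mono[of m "max n m"] n m
      by (intro insert.prems(1)[of "max n m"]) auto
  qed auto
  then have "generate G S \<subseteq> {h \<in> carrier G. commutator G a h \<in> upper_central G n}"
    using S(1) by (intro generate_subgroup_incl subgroup_centralizer_modulo upper_central_normal a) auto
  then have "a \<in> upper_central G (Suc n)"
    using gen a by auto
  then show ?thesis
    unfolding hypercenter_def by blast
qed

lemma nilpotent_if_generators_hypercentral:
  assumes S: "finite S" "S \<subseteq> hypercenter G" and gen: "generate G S = carrier G"
  shows "nilpotent_group G"
proof -
  obtain n where "S \<subseteq> upper_central G n"
    using S
  proof (induction S arbitrary: thesis)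
    case (insert s S)
    obtain n where n: "S \<subseteq> upper_central G n"
      using insert by auto
    obtain m where m: "s \<in> upper_central G m"
      using insert.prems(2) by (auto simp: hypercenter_def)
    show ?case
      using upper_central_mono[of n "max n m"] upper_central_mono[of m "max n m"] n m
      by (intro insert.prems(1)[of "max n m"]) auto
  qed auto
  then have n: "carrier G \<subseteq> upper_central G n"
    using gen generate_subgroup_incl[OF _ normal_imp_subgroup[OF upper_central_normal]] by blast
  have "lower_central G i \<subseteq> upper_central G (n - i)" if "i \<le> n" for i
    using that
  proof (induction i)
    case (Suc i)
    have "n - i = Suc (n - Suc i)"
      using Suc.prems by simp
    then have "lower_central G i \<subseteq> upper_central G (Suc (n - Suc i))"
      using Suc by simp
    then show ?case
      unfolding lower_central.simps
      by (intro generate_subgroup_incl normal_imp_subgroup upper_central_normal) auto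
  qed (use n in simp)
  then have "lower_central G n \<subseteq> {\<one>}"
    using upper_central.simps(1)[of G] by (metis diff_self_eq_0 order_refl)
  moreover have "\<one> \<in> lower_central G n"
    by (cases n) (auto intro: generate.one)
  ultimately show ?thesis
    unfolding nilpotent_group_def nilpotent_class_le_def using is_group by blast
qed

lemma commutator_Mod:
  assumes N: "N \<lhd> G" and "a \<in> carrier G" "b \<in> carrier G"
  shows "commutator (G Mod N) (N #> a) (N #> b) = N #> commutator G a b"
proof -
  interpret N: normal N G by (rule N)
  show ?thesis
    using assms by (simp add: commutator_def N.inv_FactGroup carrier_FactGroup N.rcos_inv N.rcos_sum)
qed

text \<open>The third term of the lower central series of the quotient is trivial, and it contains the coset
  of every triple commutator.\<close>
lemma triple_commutator_mem:
  assumes N: "N \<lhd> G" and nil: "nilpotent_class_le 2 (G Mod N)"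
    and abd: "a \<in> carrier G" "b \<in> carrier G" "d \<in> carrier G"
  shows "commutator G (commutator G a b) d \<in> N"
proof -
  interpret N: normal N G by (rule N)
  have in_Mod: "N #> g \<in> carrier (G Mod N)" if "g \<in> carrier G" for g
    using that by (auto simp: carrier_FactGroup)
  have "N #> commutator G a b \<in> lower_central (G Mod N) 1"
    using in_Mod abd commutator_Mod[OF N, of a b] by (auto intro!: generate.incl)
  then have "N #> commutator G (commutator G a b) d \<in> lower_central (G Mod N) 2"
    using in_Mod abd commutator_Mod[OF N, of "commutator G a b" d]
    unfolding numeral_2_eq_2 lower_central.simps(2)[of _ "Suc 0"]
    by (auto intro!: generate.incl simp del: lower_central.simps)
  then have "N #> commutator G (commutator G a b) d = N"
    using nil by (simp add: nilpotent_class_le_def)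
  then show ?thesis
    using abd rcos_self[of "commutator G (commutator G a b) d" N] N.subgroup_axioms by simp
qed

end

section \<open>Modules over the Heisenberg group\<close>

text \<open>Operators are read as acting on the right, so \<open>eta_xi\<close> is the relation \<open>\<xi>\<eta> = \<eta>\<xi>\<zeta>\<close>.\<close>
locale heisenberg_action =
  fixes \<xi> \<eta> \<zeta> :: "'m::ab_group_add \<Rightarrow> 'm"
  assumes xi_diff: "\<xi> (a - b) = \<xi> a - \<xi> b"
    and eta_diff: "\<eta> (a - b) = \<eta> a - \<eta> b"
    and zeta_diff: "\<zeta> (a - b) = \<zeta> a - \<zeta> b"
    and zeta_xi: "\<zeta> (\<xi> w) = \<xi> (\<zeta> w)"
    and zeta_eta: "\<zeta> (\<eta> w) = \<eta> (\<zeta> w)"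
    and eta_xi: "\<eta> (\<xi> w) = \<zeta> (\<xi> (\<eta> w))"
begin

text \<open>The equivalences say that the three operators act injectively on the quotient by \<open>K\<close>; the last
  clause says that the quotient has no nonzero common fixed vector of \<open>\<xi>\<close> and \<open>\<eta>\<close>. All clauses
  pass to unions of chains and to preimages under central operators.\<close>
definition isolated :: "'m set \<Rightarrow> bool" where
  "isolated K \<longleftrightarrow> 0 \<in> K \<and> (\<forall>a\<in>K. \<forall>b\<in>K. a - b \<in> K)
     \<and> (\<forall>w. \<xi> w \<in> K \<longleftrightarrow> w \<in> K) \<and> (\<forall>w. \<eta> w \<in> K \<longleftrightarrow> w \<in> K) \<and> (\<forall>w. \<zeta> w \<in> K \<longleftrightarrow> w \<in> K)
     \<and> (\<forall>w. \<xi> w - w \<in> K \<longrightarrow> \<eta> w - w \<in> K \<longrightarrow> w \<in> K)"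

definition central_modulo :: "'m set \<Rightarrow> ('m \<Rightarrow> 'm) \<Rightarrow> bool" where
  "central_modulo K Z \<longleftrightarrow> (\<forall>a b. Z (a - b) = Z a - Z b) \<and> (\<forall>w\<in>K. Z w \<in> K)
     \<and> (\<forall>w. Z (\<xi> w) - \<xi> (Z w) \<in> K) \<and> (\<forall>w. Z (\<eta> w) - \<eta> (Z w) \<in> K) \<and> (\<forall>w. Z (\<zeta> w) - \<zeta> (Z w) \<in> K)"

text \<open>The operator \<open>\<xi>\<zeta>\<^sup>i - 1\<close>, whose kernel is the eigenspace of \<open>\<xi>\<close> for the "eigenvalue" \<open>\<zeta>\<^sup>-\<^sup>i\<close>.
  Products of such operators are encoded by lists of exponents, as \<open>fold fac is\<close>.\<close>
definition fac :: "nat \<Rightarrow> 'm \<Rightarrow> 'm" where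
  "fac i w = \<xi> ((\<zeta> ^^ i) w) - w"

lemma zeta_pow_diff: "(\<zeta> ^^ i) (a - b) = (\<zeta> ^^ i) a - (\<zeta> ^^ i) b"
  by (induction i) (simp_all add: zeta_diff)

lemma zeta_pow_xi: "(\<zeta> ^^ i) (\<xi> w) = \<xi> ((\<zeta> ^^ i) w)"
  by (induction i) (simp_all add: zeta_xi)

lemma zeta_pow_eta: "(\<zeta> ^^ i) (\<eta> w) = \<eta> ((\<zeta> ^^ i) w)"
  by (induction i) (simp_all add: zeta_eta)

lemma zeta_pow_zeta_pow: "(\<zeta> ^^ i) ((\<zeta> ^^ j) w) = (\<zeta> ^^ j) ((\<zeta> ^^ i) w)"
  by (simp add: add.commute flip: funpow_add[THEN fun_cong, unfolded comp_def])

lemma fac_diff: "fac i (a - b) = fac i a - fac i b"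
  by (simp add: fac_def xi_diff zeta_pow_diff)

lemma fac_xi: "fac i (\<xi> w) = \<xi> (fac i w)"
  by (simp add: fac_def xi_diff zeta_pow_xi)

lemma fac_zeta: "fac i (\<zeta> w) = \<zeta> (fac i w)"
  by (simp add: fac_def zeta_diff zeta_xi flip: funpow_swap1)

text \<open>The step on which the whole argument rests: \<open>\<eta>\<close> carries eigenvectors of \<open>\<xi>\<close> to
  eigenvectors for the next exponent.\<close>
lemma fac_eta_Suc: "fac (Suc i) (\<eta> w) = \<eta> (fac i w)"
  by (simp add: fac_def eta_diff eta_xi zeta_xi zeta_eta zeta_pow_eta)

lemma fac_commute: "fac i (fac j w) = fac j (fac i w)"
  by (simp add: fac_def xi_diff zeta_pow_diff zeta_pow_xi zeta_pow_zeta_pow[of i j])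

lemma fold_fac_diff: "fold fac is (a - b) = fold fac is a - fold fac is b"
  by (induction "is" arbitrary: a b) (simp_all add: fac_diff)

lemma fold_fac_xi: "fold fac is (\<xi> w) = \<xi> (fold fac is w)"
  by (induction "is" arbitrary: w) (simp_all add: fac_xi)

lemma fold_fac_zeta: "fold fac is (\<zeta> w) = \<zeta> (fold fac is w)"
  by (induction "is" arbitrary: w) (simp_all add: fac_zeta)

lemma fold_fac_eta_Suc: "fold fac (map Suc is) (\<eta> w) = \<eta> (fold fac is w)"
  by (induction "is" arbitrary: w) (simp_all add: fac_eta_Suc)

lemma fold_fac_eta_pow: "fold fac (map (\<lambda>i. i + j) is) ((\<eta> ^^ j) w) = (\<eta> ^^ j) (fold fac is w)"
proof (induction j)
  case (Suc j)
  have "map (\<lambda>i. i + Suc j) is = map Suc (map (\<lambda>i. i + j) is)"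
    by simp
  then show ?case
    using Suc by (simp only: fold_fac_eta_Suc funpow.simps comp_apply)
qed simp

lemma fold_fac_fac: "fold fac is (fac j w) = fac j (fold fac is w)"
proof (induction "is" arbitrary: w)
  case (Cons i "is")
  then show ?case
    by (simp add: fac_commute[of i j])
qed simp

lemma fold_fac_fold_fac: "fold fac is (fold fac js w) = fold fac js (fold fac is w)"
  by (induction js arbitrary: w) (simp_all flip: fold_fac_fac)

lemma isolated_zero: "isolated K \<Longrightarrow> 0 \<in> K"
  and isolated_diff: "isolated K \<Longrightarrow> a \<in> K \<Longrightarrow> b \<in> K \<Longrightarrow> a - b \<in> K"
  and isolated_xi: "isolated K \<Longrightarrow> \<xi> w \<in> K \<longleftrightarrow> w \<in> K"
  and isolated_eta: "isolated K \<Longrightarrow> \<eta> w \<in> K \<longleftrightarrow> w \<in> K"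
  and isolated_zeta: "isolated K \<Longrightarrow> \<zeta> w \<in> K \<longleftrightarrow> w \<in> K"
  and isolated_fixed: "isolated K \<Longrightarrow> \<xi> w - w \<in> K \<Longrightarrow> \<eta> w - w \<in> K \<Longrightarrow> w \<in> K"
  unfolding isolated_def by blast+

text \<open>Applied to a maximal \<open>K\<close>, this makes every central operator zero or injective modulo \<open>K\<close>.\<close>
lemma isolated_preimage:
  assumes K: "isolated K" and Z: "central_modulo K Z"
  shows "isolated {w. Z w \<in> K}"
proof -
  have cong: "a \<in> K \<longleftrightarrow> b \<in> K" if "a - b \<in> K" for a b
  proof -
    have "b = a - (a - b)" "a = (a - b) - (0 - b)" by simp_all
    then show ?thesis using isolated_zero[OF K] isolated_diff[OF K] that by metis
  qed
  have Zd: "Z (a - b) = Z a - Z b" for a b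
    using Z by (simp add: central_modulo_def)
  have Z0: "Z 0 = 0"
    using Zd[of 0 0] by simp
  have \<xi>: "Z (\<xi> w) - \<xi> (Z w) \<in> K" and \<eta>: "Z (\<eta> w) - \<eta> (Z w) \<in> K"
    and \<zeta>: "Z (\<zeta> w) - \<zeta> (Z w) \<in> K" for w
    using Z by (auto simp: central_modulo_def)
  have diff: "\<xi> (Z w) - Z w \<in> K" if "Z (\<xi> w) - Z w \<in> K" for w
    using cong[of "Z (\<xi> w) - Z w" "\<xi> (Z w) - Z w"] \<xi>[of w] that by simp
  have diff': "\<eta> (Z w) - Z w \<in> K" if "Z (\<eta> w) - Z w \<in> K" for w
    using cong[of "Z (\<eta> w) - Z w" "\<eta> (Z w) - Z w"] \<eta>[of w] that by simp
  show ?thesis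
    unfolding isolated_def
  proof (intro conjI allI impI ballI)
    fix w assume "\<xi> w - w \<in> {w. Z w \<in> K}" "\<eta> w - w \<in> {w. Z w \<in> K}"
    then have "\<xi> (Z w) - Z w \<in> K" "\<eta> (Z w) - Z w \<in> K"
      using diff diff' by (simp_all add: Zd)
    then show "w \<in> {w. Z w \<in> K}"
      by (blast dest: isolated_fixed[OF K])
  qed (simp_all add: isolated_zero[OF K] isolated_diff[OF K] isolated_xi[OF K] isolated_eta[OF K]
      isolated_zeta[OF K] Zd Z0 cong[OF \<xi>] cong[OF \<eta>] cong[OF \<zeta>])
qed

end

section \<open>Prime submodules\<close>

text \<open>Modulo \<open>K\<close>, central operators behave like the scalars of a vector space over a field, as far as
  vanishing is concerned. Membership in \<open>K\<close> is read as vanishing.\<close>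
locale prime_heisenberg = heisenberg_action \<xi> \<eta> \<zeta> for \<xi> \<eta> \<zeta> :: "'m::ab_group_add \<Rightarrow> 'm" +
  fixes K :: "'m set"
  assumes isolated: "isolated K"
    and prime: "central_modulo K Z \<Longrightarrow> (\<forall>w. Z w \<in> K) \<or> (\<forall>w. Z w \<in> K \<longrightarrow> w \<in> K)"
begin

lemma zero_mem: "0 \<in> K" and diff_mem: "a \<in> K \<Longrightarrow> b \<in> K \<Longrightarrow> a - b \<in> K"
  and xi_mem: "\<xi> w \<in> K \<longleftrightarrow> w \<in> K" and eta_mem: "\<eta> w \<in> K \<longleftrightarrow> w \<in> K" and zeta_mem: "\<zeta> w \<in> K \<longleftrightarrow> w \<in> K"
  and fixed_mem: "\<xi> w - w \<in> K \<Longrightarrow> \<eta> w - w \<in> K \<Longrightarrow> w \<in> K"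
  using isolated
  by (blast intro: isolated_zero isolated_diff isolated_fixed isolated_xi[THEN iffD1] isolated_xi[THEN iffD2]
      isolated_eta[THEN iffD1] isolated_eta[THEN iffD2] isolated_zeta[THEN iffD1] isolated_zeta[THEN iffD2])+

lemma mem_cong: "a - b \<in> K \<Longrightarrow> a \<in> K \<longleftrightarrow> b \<in> K"
proof -
  assume ab: "a - b \<in> K"
  have "b = a - (a - b)" "a = (a - b) - (0 - b)" by simp_all
  then show ?thesis using ab diff_mem zero_mem by metis
qed

lemma add_mem: "a \<in> K \<Longrightarrow> b \<in> K \<Longrightarrow> a + b \<in> K"
  using mem_cong[of "a + b" a] by simp

lemma zeta_pow_mem: "(\<zeta> ^^ i) w \<in> K \<longleftrightarrow> w \<in> K"
  by (induction i) (simp_all add: zeta_mem)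

lemma eta_pow_mem: "(\<eta> ^^ i) w \<in> K \<longleftrightarrow> w \<in> K"
  by (induction i) (simp_all add: eta_mem)

lemma fac_mem: "w \<in> K \<Longrightarrow> fac i w \<in> K"
  by (simp add: fac_def diff_mem xi_mem zeta_pow_mem)

lemma fold_fac_mem: "w \<in> K \<Longrightarrow> fold fac is w \<in> K"
  by (induction "is" arbitrary: w) (simp_all add: fac_mem)

lemma zeta_pow_central: "central_modulo K (\<lambda>w. (\<zeta> ^^ i) w - w)"
  by (simp add: central_modulo_def zeta_pow_diff diff_mem zeta_pow_mem zeta_pow_xi zeta_pow_eta xi_diff eta_diff zeta_diff
      funpow_swap1[of \<zeta>] zero_mem)

text \<open>A substitute for Bezout: a vector annihilated by two products of commuting operators vanishes
  if no nonzero vector is annihilated by a factor of each. The factors are removed one at a time.\<close>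
lemma mem_if_coprime:
  assumes comm: "\<And>f g w. f \<in> set fs \<Longrightarrow> g \<in> set gs \<Longrightarrow> f (g w) = g (f w)"
    and cop: "\<And>f g w. f \<in> set fs \<Longrightarrow> g \<in> set gs \<Longrightarrow> f w \<in> K \<Longrightarrow> g w \<in> K \<Longrightarrow> w \<in> K"
    and pres: "\<And>f w. f \<in> set fs \<union> set gs \<Longrightarrow> w \<in> K \<Longrightarrow> f w \<in> K"
    and "fold (\<lambda>f. f) fs w \<in> K" and "fold (\<lambda>f. f) gs w \<in> K"
  shows "w \<in> K"
proof -
  have move: "fold (\<lambda>f. f) hs (f w) = f (fold (\<lambda>f. f) hs w)" if "f \<in> set fs" "set hs \<subseteq> set gs" for f hs w
    using that
  proof (induction hs arbitrary: w)
    case (Cons g hs)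
    then show ?case
      using comm[of f g w, symmetric] by simp
  qed simp
  \<comment> \<open>The case where the first product has a single factor.\<close>
  have single: "w \<in> K" if "f \<in> set fs" "f w \<in> K" "fold (\<lambda>f. f) hs w \<in> K" "set hs \<subseteq> set gs" for f hs w
    using that
  proof (induction hs arbitrary: w)
    case (Cons g hs)
    have "f (g w) \<in> K"
      using Cons.prems comm[of f g w] pres[of g "f w"] by simp
    then have "g w \<in> K"
      using Cons by simp
    then show ?case
      using Cons.prems cop[of f g w] by simp
  qed simp
  have "w \<in> K" if "fold (\<lambda>f. f) hs w \<in> K" "fold (\<lambda>f. f) gs w \<in> K" "set hs \<subseteq> set fs" for hs w
    using that
  proof (induction hs arbitrary: w)
    case (Cons f hs)
    have "f w \<in> K"
      using Cons move[of f gs w] pres[of f "fold (\<lambda>f. f) gs w"] by simp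
    then show ?case
      using Cons.prems single[of f w gs] by simp
  qed simp
  then show ?thesis
    using assms by blast
qed

lemma fold_fac_eq: "fold fac is = fold (\<lambda>f. f) (map fac is)"
  by (simp add: fold_map comp_def)

text \<open>On a common eigenvector \<open>\<zeta>\<^sup>-\<^sup>i\<close> and \<open>\<zeta>\<^sup>-\<^sup>j\<close> agree, so \<open>\<zeta>\<^sup>j\<^sup>-\<^sup>i - 1\<close> annihilates it.\<close>
lemma fac_coprime:
  assumes "i < j" and inj: "\<And>w. (\<zeta> ^^ (j - i)) w - w \<in> K \<Longrightarrow> w \<in> K"
    and "fac i w \<in> K" "fac j w \<in> K"
  shows "w \<in> K"
proof -
  have "(\<zeta> ^^ i) ((\<zeta> ^^ (j - i)) w) = (\<zeta> ^^ j) w"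
    using \<open>i < j\<close> by (simp flip: funpow_add[THEN fun_cong, unfolded comp_def])
  then have "fac j w - fac i w = \<xi> ((\<zeta> ^^ i) ((\<zeta> ^^ (j - i)) w - w))"
    by (simp add: fac_def zeta_pow_diff xi_diff)
  then have "(\<zeta> ^^ (j - i)) w - w \<in> K"
    using diff_mem[OF assms(4,3)] by (simp add: xi_mem zeta_pow_mem)
  then show ?thesis
    by (rule inj)
qed

lemma mem_if_fac_coprime:
  assumes less: "\<And>i j. i \<in> set is \<Longrightarrow> j \<in> set js \<Longrightarrow> i < j"
    and inj: "\<And>i j w. i \<in> set is \<Longrightarrow> j \<in> set js \<Longrightarrow> (\<zeta> ^^ (j - i)) w - w \<in> K \<Longrightarrow> w \<in> K"
    and "fold fac is w \<in> K" "fold fac js w \<in> K"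
  shows "w \<in> K"
proof (rule mem_if_coprime[of "map fac is" "map fac js"])
  show "w \<in> K"
    if fg: "f \<in> set (map fac is)" "g \<in> set (map fac js)" "f w \<in> K" "g w \<in> K" for f g w
  proof -
    obtain i j where "i \<in> set is" "f = fac i" "j \<in> set js" "g = fac j"
      using fg by auto
    then show ?thesis
      using fg(3,4) by (metis fac_coprime less inj)
  qed
qed (use assms(3,4) in \<open>auto simp: fac_commute fac_mem fold_fac_eq\<close>)

text \<open>The case of infinite order. By induction on \<open>m\<close>, the vector \<open>w(\<eta> - 1)\<close> vanishes: it is annihilated
  by the product for \<open>w\<close> times its shift. Then \<open>w\<close> equals all its translates under \<open>\<eta>\<close>, and a far
  translate has exponents disjoint from those of \<open>w\<close>.\<close>
lemma mem_if_eta_unipotent: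
  assumes inj: "\<And>i w. 0 < i \<Longrightarrow> (\<zeta> ^^ i) w - w \<in> K \<Longrightarrow> w \<in> K"
    and "((\<lambda>w. \<eta> w - w) ^^ m) w \<in> K" and "fold fac is w \<in> K"
  shows "w \<in> K"
  using assms(2,3)
proof (induction m arbitrary: w "is")
  case (Suc m)
  have "fold fac (is @ map Suc is) (\<eta> w - w) = fold fac (map Suc is) (fold fac is (\<eta> w)) - fold fac (map Suc is) (fold fac is w)"
    by (simp add: fold_fac_diff)
  moreover have "fold fac (map Suc is) (fold fac is (\<eta> w)) = fold fac is (\<eta> (fold fac is w))"
    by (metis fold_fac_fold_fac fold_fac_eta_Suc)
  ultimately have "fold fac (is @ map Suc is) (\<eta> w - w) \<in> K"
    using Suc.prems by (simp only: diff_mem fold_fac_mem eta_mem)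
  moreover have "((\<lambda>w. \<eta> w - w) ^^ m) (\<eta> w - w) \<in> K"
    using Suc.prems by (simp only: funpow_Suc_right comp_apply)
  ultimately have fixed: "\<eta> w - w \<in> K"
    using Suc.IH by blast
  have eta_pow: "(\<eta> ^^ j) w - w \<in> K" for j
  proof (induction j)
    case (Suc j)
    have "\<eta> (((\<eta> ^^ j) w) - w) + (\<eta> w - w) \<in> K"
      using Suc fixed by (intro add_mem) (simp_all add: eta_mem)
    then show ?case by (simp add: eta_diff)
  qed (simp add: zero_mem)
  \<comment> \<open>A shift by more than the largest exponent makes the two exponent lists disjoint.\<close>
  define j where "j = Suc (Max (insert 0 (set is)))"
  have lt: "i < j" if "i \<in> set is" for i
    using that by (simp add: j_def le_imp_less_Suc)
  let ?js = "map (\<lambda>i. i + j) is"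
  have "fold fac ?js ((\<eta> ^^ j) w - w) \<in> K"
    using eta_pow fold_fac_mem by blast
  moreover have "fold fac ?js ((\<eta> ^^ j) w) \<in> K"
    using Suc.prems by (simp add: fold_fac_eta_pow eta_pow_mem)
  ultimately have "fold fac ?js w \<in> K"
    by (simp add: fold_fac_diff mem_cong)
  moreover have less: "i < l" if "i \<in> set is" "l \<in> set ?js" for i l
    using that lt[of i] by auto
  ultimately show ?case
    using mem_if_fac_coprime[of "is" ?js w, OF less] Suc.prems inj by (metis zero_less_diff)
qed simp

end

section \<open>The Engel relations modulo a prime submodule\<close>

locale prime_heisenberg_engel = prime_heisenberg \<xi> \<eta> \<zeta> K for \<xi> \<eta> \<zeta> :: "'m::ab_group_add \<Rightarrow> 'm" and K +
  fixes u v :: 'm and k m :: nat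
  assumes u_engel: "((\<lambda>w. \<xi> w - w) ^^ k) u \<in> K"
    and v_engel: "((\<lambda>w. \<eta> w - w) ^^ m) v \<in> K"
    and relation: "(\<eta> u - \<zeta> u) - (\<xi> (\<zeta> v) - v) \<in> K"
begin

lemma mem_if_funpow_mem: "(f ^^ n) w \<in> K \<Longrightarrow> (\<And>w. f w \<in> K \<Longrightarrow> w \<in> K) \<Longrightarrow> w \<in> K"
  by (induction n) auto

text \<open>With \<open>\<zeta> = 1\<close> the operators \<open>\<xi>\<close> and \<open>\<eta>\<close> commute and the relation becomes
  \<open>u(\<eta> - 1) = v(\<xi> - 1)\<close>, so primality applies to \<open>\<xi> - 1\<close> and \<open>\<eta> - 1\<close> themselves.\<close>
lemma both_mem_if_zeta_trivial:
  assumes C1: "\<And>w. \<zeta> w - w \<in> K"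
  shows "u \<in> K \<and> v \<in> K"
proof -
  have comm: "\<eta> (\<xi> w) - \<xi> (\<eta> w) \<in> K" for w
    using C1[of "\<xi> (\<eta> w)"] by (simp add: eta_xi)
  have comm': "\<xi> (\<eta> w) - \<eta> (\<xi> w) \<in> K" for w
    using diff_mem[OF zero_mem comm[of w]] by simp
  have "central_modulo K (\<lambda>w. \<xi> w - w)" "central_modulo K (\<lambda>w. \<eta> w - w)"
    using comm comm'
    by (auto simp: central_modulo_def xi_diff eta_diff zeta_diff diff_mem xi_mem eta_mem zeta_xi zeta_eta zero_mem)
  then have X01: "(\<forall>w. \<xi> w - w \<in> K) \<or> (\<forall>w. \<xi> w - w \<in> K \<longrightarrow> w \<in> K)"
    and Y01: "(\<forall>w. \<eta> w - w \<in> K) \<or> (\<forall>w. \<eta> w - w \<in> K \<longrightarrow> w \<in> K)"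
    using prime by blast+
  have "\<xi> (\<zeta> v - v) + (\<zeta> u - u) + ((\<eta> u - \<zeta> u) - (\<xi> (\<zeta> v) - v)) \<in> K"
    by (intro add_mem relation) (simp_all add: xi_mem C1)
  then have rel: "(\<eta> u - u) - (\<xi> v - v) \<in> K"
    by (simp add: xi_diff algebra_simps)
  consider "\<forall>w. \<xi> w - w \<in> K" "\<forall>w. \<eta> w - w \<in> K" | "\<forall>w. \<xi> w - w \<in> K \<longrightarrow> w \<in> K" | "\<forall>w. \<eta> w - w \<in> K \<longrightarrow> w \<in> K"
    using X01 Y01 by blast
  then show ?thesis
  proof cases
    case 1
    then show ?thesis using fixed_mem by blast
  next
    case 2
    then have "u \<in> K"
      using mem_if_funpow_mem u_engel by blast
    then have "\<xi> v - v \<in> K"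
      using mem_cong[OF rel] by (simp add: eta_mem diff_mem)
    with 2 \<open>u \<in> K\<close> show ?thesis
      by blast
  next
    case 3
    then have "v \<in> K"
      using mem_if_funpow_mem v_engel by blast
    then have "\<eta> u - u \<in> K"
      using mem_cong[OF rel] by (simp add: xi_mem diff_mem)
    with 3 \<open>v \<in> K\<close> show ?thesis
      by blast
  qed
qed

lemma fac_0: "fac 0 = (\<lambda>w. \<xi> w - w)"
  by (simp add: fac_def fun_eq_iff)

lemma fac0_u: "fold fac (replicate k 0) u \<in> K"
  using u_engel by (simp add: fac_0 fold_replicate)

lemma fac1_eta_u: "fold fac (replicate k 1) (\<eta> u) \<in> K"
  using fold_fac_eta_Suc[of "replicate k 0" u] fac0_u by (simp add: eta_mem)

text \<open>The relation in the form \<open>v(\<xi>\<zeta> - 1) = u\<eta> - u\<zeta>\<close>, with further factors applied to both sides.\<close>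
lemma relation_fac: "fac 1 v \<in> K \<longleftrightarrow> \<eta> u - \<zeta> u \<in> K"
  "fac 0 (fac 1 v) \<in> K \<longleftrightarrow> fac 0 (\<eta> u - \<zeta> u) \<in> K"
  "fold fac is (fac 1 v) \<in> K \<longleftrightarrow> fold fac is (\<eta> u - \<zeta> u) \<in> K"
proof -
  have "fold fac is (\<eta> u - \<zeta> u) - fold fac is (fac 1 v) \<in> K" for "is"
    using fold_fac_mem[OF relation, of "is"] by (simp add: fold_fac_diff fac_def)
  then show *: "fold fac is (fac 1 v) \<in> K \<longleftrightarrow> fold fac is (\<eta> u - \<zeta> u) \<in> K" for "is"
    using mem_cong by blast
  show "fac 1 v \<in> K \<longleftrightarrow> \<eta> u - \<zeta> u \<in> K"
    "fac 0 (fac 1 v) \<in> K \<longleftrightarrow> fac 0 (\<eta> u - \<zeta> u) \<in> K"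
    using *[of "[]"] *[of "[0]"] by simp_all
qed

text \<open>In \<open>u\<eta> - u\<zeta>\<close> the first term belongs to exponent 1 and the second to exponent 0; the factor at the
  head of the list turns \<open>v\<close> into this difference.\<close>
lemma fac_annihilates_v: "fold fac (1 # replicate k 1 @ replicate k 0) v \<in> K"
proof -
  have "fold fac (replicate k 1 @ replicate k 0) (\<eta> u - \<zeta> u) \<in> K"
  proof -
    have "fold fac (replicate k 0) (fold fac (replicate k 1) (\<eta> u)) \<in> K"
      by (intro fold_fac_mem fac1_eta_u)
    moreover have "fold fac (replicate k 1) (fold fac (replicate k 0) (\<zeta> u)) \<in> K"
      using fac0_u by (simp add: fold_fac_zeta fold_fac_mem zeta_mem del: fold_replicate)
    ultimately show ?thesis
      by (simp add: fold_fac_diff diff_mem fold_fac_fold_fac[of "replicate k 0"] del: fold_replicate)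
  qed
  then show ?thesis
    by (simp only: relation_fac(3) fold_simps)
qed

text \<open>If \<open>v = 0\<close> then \<open>u\<eta> = u\<zeta>\<close>, so \<open>u\<close> belongs to the exponents 0 and 1 at the same time.\<close>
lemma u_mem_if_v_mem:
  assumes inj: "\<And>w. \<zeta> w - w \<in> K \<Longrightarrow> w \<in> K" and "v \<in> K"
  shows "u \<in> K"
proof -
  have "\<eta> u - \<zeta> u \<in> K"
    using \<open>v \<in> K\<close> relation_fac(1) fac_mem by blast
  then have "fold fac (replicate k 1) (\<zeta> u) \<in> K"
    using fac1_eta_u fold_fac_mem fold_fac_diff mem_cong by metis
  then have "fold fac (replicate k 1) u \<in> K"
    by (simp only: fold_fac_zeta zeta_mem)
  with fac0_u show ?thesis
  proof (rule mem_if_fac_coprime[rotated 2])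
    show "w \<in> K" if "i \<in> set (replicate k 0)" "j \<in> set (replicate k 1)" "(\<zeta> ^^ (j - i)) w - w \<in> K" for i j w
      by (rule inj) (use that in auto)
  qed auto
qed

text \<open>If \<open>u = 0\<close> then \<open>v = v\<xi>\<zeta>\<close>. Since \<open>\<xi>\<close> turns generalised \<open>\<eta>\<close>-eigenvectors for 1 into such vectors
  for \<open>\<zeta>\<close>, the vector \<open>v\<close> belongs to both eigenvalues of \<open>\<eta>\<close>.\<close>
lemma v_mem_if_u_mem:
  assumes inj: "\<And>w. \<zeta> w - w \<in> K \<Longrightarrow> w \<in> K" and "u \<in> K"
  shows "v \<in> K"
proof -
  have rel: "\<xi> (\<zeta> v) - v \<in> K"
    using \<open>u \<in> K\<close> relation_fac(1) by (simp add: fac_def diff_mem eta_mem zeta_mem)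
  have funpow_mem: "(f ^^ n) w \<in> K" if "w \<in> K" "\<And>w. w \<in> K \<Longrightarrow> f w \<in> K" for f :: "'m \<Rightarrow> 'm" and n w
    using that by (induction n) auto
  have "((\<lambda>w. \<eta> w - w) ^^ n) (\<zeta> w) = \<zeta> (((\<lambda>w. \<eta> w - w) ^^ n) w)" for n w
    by (induction n) (simp_all add: zeta_diff zeta_eta)
  then have \<delta>: "((\<lambda>w. \<eta> w - w) ^^ m) (\<zeta> v) \<in> K"
    using v_engel by (simp add: zeta_mem)
  have "((\<lambda>w. \<eta> w - \<zeta> w) ^^ n) (\<xi> w) = \<xi> ((\<zeta> ^^ n) (((\<lambda>w. \<eta> w - w) ^^ n) w))" for n w
    by (induction n) (simp_all add: eta_xi zeta_xi zeta_pow_diff zeta_pow_eta zeta_diff zeta_eta xi_diff)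
  then have "((\<lambda>w. \<eta> w - \<zeta> w) ^^ m) (\<xi> (\<zeta> v)) \<in> K"
    using \<delta> by (simp add: xi_mem zeta_pow_mem)
  moreover have "((\<lambda>w. \<eta> w - \<zeta> w) ^^ m) (\<xi> (\<zeta> v) - v) \<in> K"
    using rel by (rule funpow_mem) (simp add: diff_mem eta_mem zeta_mem)
  moreover have "((\<lambda>w. \<eta> w - \<zeta> w) ^^ n) (a - b) = ((\<lambda>w. \<eta> w - \<zeta> w) ^^ n) a - ((\<lambda>w. \<eta> w - \<zeta> w) ^^ n) b" for a b n
    by (induction n) (simp_all add: eta_diff zeta_diff)
  ultimately have "((\<lambda>w. \<eta> w - \<zeta> w) ^^ m) v \<in> K"
    by (simp add: mem_cong)
  then have "fold (\<lambda>f. f) (replicate m (\<lambda>w. \<eta> w - \<zeta> w)) v \<in> K"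
    by simp
  moreover have "fold (\<lambda>f. f) (replicate m (\<lambda>w. \<eta> w - w)) v \<in> K"
    using v_engel by simp
  ultimately show ?thesis
  proof (rule mem_if_coprime[where fs = "replicate m (\<lambda>w. \<eta> w - \<zeta> w)" and gs = "replicate m (\<lambda>w. \<eta> w - w)", rotated 3])
    show "w \<in> K" if "f \<in> set (replicate m (\<lambda>w. \<eta> w - \<zeta> w))" "g \<in> set (replicate m (\<lambda>w. \<eta> w - w))"
      "f w \<in> K" "g w \<in> K" for f g w
    proof (rule inj)
      have "g w - f w = \<zeta> w - w" using that by auto
      then show "\<zeta> w - w \<in> K" using that diff_mem by metis
    qed
  qed (auto simp: eta_diff zeta_diff zeta_eta diff_mem eta_mem zeta_mem)
qed

text \<open>Let \<open>Z\<close> be the product of all \<open>\<xi>\<zeta>\<^sup>i - 1\<close> with \<open>i < l\<close>. Conjugation by \<open>\<eta>\<close> permutes its factors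
  cyclically, so \<open>Z\<close> is central. If it is injective then so is its factor \<open>\<xi> - 1\<close>, which is nilpotent
  on \<open>u\<close>. If it is zero, each eigenvalue of \<open>\<xi>\<close> is a simple root: the powers of
  \<open>\<xi> - 1\<close> and \<open>\<xi>\<zeta> - 1\<close> in the annihilators of \<open>u\<close> and \<open>v\<close> reduce to exponent 1. Then
  \<open>(u\<eta> - u\<zeta>)(\<xi> - 1) = v(\<xi>\<zeta> - 1)(\<xi> - 1) = 0\<close> and \<open>u(\<xi> - 1) = 0\<close>, so \<open>u\<eta>\<close> has exponent 0 as well as 1.\<close>
lemma both_mem_if_zeta_order:
  assumes "2 \<le> l" and Cl: "\<And>w. (\<zeta> ^^ l) w - w \<in> K"
    and inj: "\<And>i w. 0 < i \<Longrightarrow> i < l \<Longrightarrow> (\<zeta> ^^ i) w - w \<in> K \<Longrightarrow> w \<in> K"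
  shows "u \<in> K \<and> v \<in> K"
proof -
  have inj1: "w \<in> K" if "\<zeta> w - w \<in> K" for w
    by (rule inj[of 1]) (use that \<open>2 \<le> l\<close> in simp_all)
  define Z where "Z = fold fac [0..<l]"
  have upt0: "[0..<l] = 0 # [1..<l]" and upt1: "[1..<l] = 1 # [2..<l]"
    using \<open>2 \<le> l\<close> by (simp_all add: upt_conv_Cons numeral_2_eq_2)
  have "Z (\<eta> w) - \<eta> (Z w) \<in> K" for w
  proof -
    have "map Suc [0..<l] = [1..<l] @ [l]"
      using \<open>2 \<le> l\<close> by (simp add: map_Suc_upt)
    then have "\<eta> (Z w) = fac l (fold fac [1..<l] (\<eta> w))"
      unfolding Z_def fold_fac_eta_Suc[symmetric] by simp
    moreover have "Z (\<eta> w) = fac 0 (fold fac [1..<l] (\<eta> w))"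
      by (simp add: Z_def upt0 fold_fac_fac)
    moreover have "fac 0 z - fac l z = \<xi> (z - (\<zeta> ^^ l) z)" for z
      by (simp add: fac_def xi_diff)
    moreover have "z - (\<zeta> ^^ l) z \<in> K" for z
      using diff_mem[OF zero_mem Cl[of z]] by simp
    ultimately show ?thesis
      by (simp add: xi_mem)
  qed
  then have "central_modulo K Z"
    by (simp add: central_modulo_def Z_def fold_fac_diff fold_fac_mem fold_fac_xi fold_fac_zeta zero_mem)
  then consider "\<forall>w. Z w \<in> K" | "\<forall>w. Z w \<in> K \<longrightarrow> w \<in> K"
    using prime by blast
  then have "u \<in> K"
  proof cases
    case 1
    have "fac 0 u \<in> K"
    proof (rule mem_if_fac_coprime[of "replicate k 0" "[1..<l]"])
      show "fold fac (replicate k 0) (fac 0 u) \<in> K"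
        using fac0_u by (simp only: fold_fac_fac fac_mem)
      show "fold fac [1..<l] (fac 0 u) \<in> K"
        using 1 by (simp add: Z_def upt0)
      show "w \<in> K" if "i \<in> set (replicate k 0)" "j \<in> set [1..<l]" "(\<zeta> ^^ (j - i)) w - w \<in> K" for i j w
        by (rule inj[of "j - i"]) (use that in auto)
    qed auto
    have "fac 0 (fac 1 v) \<in> K"
    proof (rule mem_if_fac_coprime[of "replicate k 1 @ replicate k 0" "[2..<l]"])
      show "fold fac (replicate k 1 @ replicate k 0) (fac 0 (fac 1 v)) \<in> K"
        using fac_mem[OF fac_annihilates_v, of 0] by (simp only: fold_fac_fac fold_simps)
      show "fold fac [2..<l] (fac 0 (fac 1 v)) \<in> K"
        using 1 unfolding Z_def upt0 upt1 by (simp add: fac_commute[of 0])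
      show "w \<in> K" if "i \<in> set (replicate k 1 @ replicate k 0)" "j \<in> set [2..<l]"
        "(\<zeta> ^^ (j - i)) w - w \<in> K" for i j w
        by (rule inj[of "j - i"]) (use that in auto)
    qed auto
    then have "fac 0 (\<eta> u) - \<zeta> (fac 0 u) \<in> K"
      by (simp only: relation_fac(2) fac_diff fac_zeta)
    then have "fac 0 (\<eta> u) \<in> K"
      using \<open>fac 0 u \<in> K\<close> mem_cong zeta_mem by blast
    moreover have "fac 1 (\<eta> u) \<in> K"
      using \<open>fac 0 u \<in> K\<close> fac_eta_Suc[of 0 u] by (simp add: eta_mem)
    ultimately have "\<eta> u \<in> K"
      by (rule fac_coprime[of 0 1 "\<eta> u", rotated 2]) (simp, rule inj1, simp)
    then show ?thesis
      by (simp add: eta_mem)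
  next
    case 2
    have "Z w \<in> K" if "fac 0 w \<in> K" for w
      using that by (simp add: Z_def upt0 fold_fac_mem)
    with 2 show ?thesis
      using u_engel[folded fac_0] mem_if_funpow_mem[of k "fac 0" u] by blast
  qed
  then show ?thesis
    using v_mem_if_u_mem inj1 by blast
qed

text \<open>By primality each \<open>\<zeta>\<^sup>i - 1\<close> is zero or injective; the cases are distinguished by the least \<open>i > 0\<close>
  for which it is zero.\<close>
theorem both_mem: "u \<in> K \<and> v \<in> K"
proof (cases "\<exists>l>0. \<forall>w. (\<zeta> ^^ l) w - w \<in> K")
  case True
  define l where "l = (LEAST l. l > 0 \<and> (\<forall>w. (\<zeta> ^^ l) w - w \<in> K))"
  have l: "l > 0" "\<And>w. (\<zeta> ^^ l) w - w \<in> K"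
    using LeastI_ex[OF True[unfolded Bex_def]] by (auto simp: l_def)
  have inj: "w \<in> K" if "0 < i" "i < l" "(\<zeta> ^^ i) w - w \<in> K" for i w
    using that prime[OF zeta_pow_central[of i]] not_less_Least[of i] unfolding l_def by blast
  show ?thesis
  proof (cases "l = 1")
    case True
    show ?thesis
      by (rule both_mem_if_zeta_trivial) (use l(2) True in simp)
  next
    case False
    with l(1) have "2 \<le> l"
      by simp
    then show ?thesis
      using l(2) inj by (rule both_mem_if_zeta_order)
  qed
next
  case False
  have inj: "w \<in> K" if "0 < i" "(\<zeta> ^^ i) w - w \<in> K" for i w
    using that False prime[OF zeta_pow_central[of i]] by blast
  have "v \<in> K"
    by (rule mem_if_eta_unipotent[OF inj v_engel fac_annihilates_v])
  moreover have "w \<in> K" if "\<zeta> w - w \<in> K" for w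
    by (rule inj[of 1]) (use that in simp_all)
  ultimately show ?thesis
    using u_mem_if_v_mem by blast
qed

end

context heisenberg_action
begin

text \<open>The hypothesis \<open>gen\<close> says that \<open>u\<close> and \<open>v\<close> generate the module, up to isolated closure and modulo \<open>K\<^sub>0\<close>.
  It turns "kills \<open>u\<close> and \<open>v\<close>"
  into "is zero" in the dichotomy for central operators.\<close>
theorem engel_generators_mem:
  assumes K\<^sub>0: "isolated K\<^sub>0"
    and gen: "\<And>K. isolated K \<Longrightarrow> K\<^sub>0 \<subseteq> K \<Longrightarrow> u \<in> K \<Longrightarrow> v \<in> K \<Longrightarrow> K = UNIV"
    and u_engel: "((\<lambda>w. \<xi> w - w) ^^ k) u \<in> K\<^sub>0"
    and v_engel: "((\<lambda>w. \<eta> w - w) ^^ m) v \<in> K\<^sub>0"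
    and relation: "(\<eta> u - \<zeta> u) - (\<xi> (\<zeta> v) - v) \<in> K\<^sub>0"
  shows "u \<in> K\<^sub>0 \<and> v \<in> K\<^sub>0"
proof (rule ccontr)
  assume contra: "\<not> (u \<in> K\<^sub>0 \<and> v \<in> K\<^sub>0)"
  define \<A> where "\<A> = {K. isolated K \<and> K\<^sub>0 \<subseteq> K \<and> \<not> (u \<in> K \<and> v \<in> K)}"
  have "\<exists>K\<in>\<A>. \<forall>L\<in>\<A>. K \<subseteq> L \<longrightarrow> L = K"
  proof (rule subset_Zorn_nonempty)
    show "\<A> \<noteq> {}"
      using K\<^sub>0 contra by (auto simp: \<A>_def)
    fix \<C> assume \<C>: "\<C> \<noteq> {}" "subset.chain \<A> \<C>"
    then have mem: "isolated K" "K\<^sub>0 \<subseteq> K" "\<not> (u \<in> K \<and> v \<in> K)" if "K \<in> \<C>" for K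
      using that by (auto simp: subset_chain_def \<A>_def)
    have two: "\<exists>K\<in>\<C>. a \<in> K \<and> b \<in> K" if "a \<in> \<Union>\<C>" "b \<in> \<Union>\<C>" for a b
    proof -
      obtain A B where AB: "A \<in> \<C>" "a \<in> A" "B \<in> \<C>" "b \<in> B"
        using \<open>a \<in> \<Union>\<C>\<close> \<open>b \<in> \<Union>\<C>\<close> by blast
      then have "A \<subseteq> B \<or> B \<subseteq> A"
        using \<C>(2) unfolding subset_chain_def by blast
      then show ?thesis
        using AB by blast
    qed
    have "isolated (\<Union>\<C>)"
      unfolding isolated_def
    proof (intro conjI ballI allI impI)
      show "0 \<in> \<Union>\<C>"
        using \<C>(1) mem(1) isolated_zero by blast
      show "a - b \<in> \<Union>\<C>" if "a \<in> \<Union>\<C>" "b \<in> \<Union>\<C>" for a b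
        using two[OF that] mem(1) isolated_diff by blast
      show "w \<in> \<Union>\<C>" if "\<xi> w - w \<in> \<Union>\<C>" "\<eta> w - w \<in> \<Union>\<C>" for w
        using two[OF that] mem(1) isolated_fixed by blast
    qed (use mem(1) isolated_xi isolated_eta isolated_zeta in blast)+
    moreover have "\<not> (u \<in> \<Union>\<C> \<and> v \<in> \<Union>\<C>)"
      using two mem(3) by blast
    ultimately show "\<Union>\<C> \<in> \<A>"
      using \<C>(1) mem(2) by (auto simp: \<A>_def)
  qed
  then obtain K where "K \<in> \<A>" and maximal: "\<forall>L\<in>\<A>. K \<subseteq> L \<longrightarrow> L = K" ..
  then have K: "isolated K" "K\<^sub>0 \<subseteq> K" "\<not> (u \<in> K \<and> v \<in> K)"
    by (simp_all add: \<A>_def)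
  interpret prime_heisenberg_engel \<xi> \<eta> \<zeta> K u v k m
  proof unfold_locales
    fix Z assume Z: "central_modulo K Z"
    define L where "L = {w. Z w \<in> K}"
    have L: "isolated L" "K \<subseteq> L"
      using isolated_preimage[OF K(1) Z] Z by (auto simp: L_def central_modulo_def)
    show "(\<forall>w. Z w \<in> K) \<or> (\<forall>w. Z w \<in> K \<longrightarrow> w \<in> K)"
    proof (cases "u \<in> L \<and> v \<in> L")
      case True
      then have "L = UNIV"
        using gen L K(2) by blast
      then show ?thesis
        by (auto simp: L_def)
    next
      case False
      then have "L \<in> \<A>"
        using L K(2) by (auto simp: \<A>_def)
      then have "L = K"
        using L(2) maximal by blast
      then show ?thesis
        by (auto simp: L_def)
    qed
  qed (use K(1,2) u_engel v_engel relation in blast)+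
  show False
    using both_mem K(3) by blast
qed

end

section \<open>The Heisenberg module of a two-generator group\<close>

lemma (in group) commutator_one: "g \<in> carrier G \<Longrightarrow> commutator G \<one> g = \<one>"
  by (simp add: commutator_def)

lemma (in group) iter_commutator_one: "g \<in> carrier G \<Longrightarrow> iter_commutator G \<one> n g = \<one>"
  by (induction n) (simp_all add: commutator_one)

lemma iter_commutator_add: "iter_commutator G a (n + m) g = iter_commutator G (iter_commutator G a n g) m g"
  by (induction m) simp_all

definition conj_by :: "('a, 'b) monoid_scheme \<Rightarrow> 'a \<Rightarrow> 'a \<Rightarrow> 'a" where
  "conj_by G g a = inv\<^bsub>G\<^esub> g \<otimes>\<^bsub>G\<^esub> a \<otimes>\<^bsub>G\<^esub> g"

inductive_set conj_span :: "('a, 'b) monoid_scheme \<Rightarrow> 'a set \<Rightarrow> 'a set \<Rightarrow> 'a set" for G S T where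
  base: "s \<in> S \<Longrightarrow> s \<in> conj_span G S T"
| one: "\<one>\<^bsub>G\<^esub> \<in> conj_span G S T"
| mult: "a \<in> conj_span G S T \<Longrightarrow> b \<in> conj_span G S T \<Longrightarrow> a \<otimes>\<^bsub>G\<^esub> b \<in> conj_span G S T"
| inv: "a \<in> conj_span G S T \<Longrightarrow> inv\<^bsub>G\<^esub> a \<in> conj_span G S T"
| conj: "a \<in> conj_span G S T \<Longrightarrow> t \<in> T \<Longrightarrow> conj_by G t a \<in> conj_span G S T"

locale two_generator_abelian_by_class2 = group G for G (structure) +
  fixes A x y
  assumes normal: "A \<lhd> G"
    and abelian: "a \<in> A \<Longrightarrow> b \<in> A \<Longrightarrow> a \<otimes> b = b \<otimes> a"
    and class2: "\<lbrakk>a \<in> carrier G; b \<in> carrier G; d \<in> carrier G\<rbrakk> \<Longrightarrow> commutator G (commutator G a b) d \<in> A"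
    and x [simp]: "x \<in> carrier G" and y [simp]: "y \<in> carrier G"
    and generated: "generate G {x, y} = carrier G"
begin

definition c where "c = commutator G x y"
definition u where "u = commutator G c x"
definition v where "v = commutator G c y"

lemma c_closed [simp]: "c \<in> carrier G"
  by (simp add: c_def)

lemma u_in_A [simp]: "u \<in> A" and v_in_A [simp]: "v \<in> A"
  by (simp_all add: u_def v_def c_def class2)

lemma A_carrier: "a \<in> A \<Longrightarrow> a \<in> carrier G"
  using normal normal_imp_subgroup subgroup.subset by blast

lemma conj_by_closed [simp]: "g \<in> carrier G \<Longrightarrow> a \<in> carrier G \<Longrightarrow> conj_by G g a \<in> carrier G"
  by (simp add: conj_by_def)

lemma conj_by_A: "g \<in> carrier G \<Longrightarrow> a \<in> A \<Longrightarrow> conj_by G g a \<in> A"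
  unfolding conj_by_def by (rule normal_conj'[OF normal])

lemma conj_by_mult: "\<lbrakk>g \<in> carrier G; a \<in> carrier G; b \<in> carrier G\<rbrakk> \<Longrightarrow> conj_by G g (a \<otimes> b) = conj_by G g a \<otimes> conj_by G g b"
  and conj_by_inv: "\<lbrakk>g \<in> carrier G; a \<in> carrier G\<rbrakk> \<Longrightarrow> conj_by G g (inv a) = inv (conj_by G g a)"
  and conj_by_conj_by: "\<lbrakk>g \<in> carrier G; h \<in> carrier G; a \<in> carrier G\<rbrakk> \<Longrightarrow> conj_by G h (conj_by G g a) = conj_by G (g \<otimes> h) a"
  and conj_by_one: "g \<in> carrier G \<Longrightarrow> conj_by G g \<one> = \<one>"
  by (simp_all add: conj_by_def word_simps)

lemma conj_by_trivial: "a \<in> A \<Longrightarrow> b \<in> A \<Longrightarrow> conj_by G b a = a"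
  by (simp add: conj_by_def A_carrier m_assoc abelian[of a b] cancel_inv_left)

text \<open>The elements \<open>cg\<close> and \<open>gc\<close> differ by a commutator that lies in \<open>A\<close> and so acts trivially on \<open>A\<close>.\<close>
lemma conj_c_commute:
  assumes g: "g \<in> carrier G" and a: "a \<in> A"
  shows "conj_by G c (conj_by G g a) = conj_by G g (conj_by G c a)"
proof -
  let ?z = "commutator G c g"
  have z: "?z \<in> A"
    using g by (simp add: c_def class2)
  have "c \<otimes> g = g \<otimes> c \<otimes> ?z"
    using g by (simp add: commutator_def word_simps)
  then have "conj_by G g (conj_by G c a) = conj_by G ?z (conj_by G (g \<otimes> c) a)"
    using a g z by (simp add: conj_by_conj_by A_carrier)
  also have "\<dots> = conj_by G (g \<otimes> c) a"
    using a g z by (simp add: conj_by_trivial conj_by_A)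
  finally show ?thesis
    using a g by (simp add: conj_by_conj_by A_carrier)
qed

lemma conj_x_y: "a \<in> A \<Longrightarrow> conj_by G y (conj_by G x a) = conj_by G c (conj_by G x (conj_by G y a))"
  by (simp add: conj_by_conj_by A_carrier) (simp add: c_def commutator_def word_simps)

lemma commutator_conj:
  assumes "a \<in> A" "g \<in> carrier G"
  shows "commutator G a g = conj_by G g a \<otimes> inv a"
proof -
  interpret A: normal A G
    by (rule normal)
  have "commutator G a g = inv a \<otimes> conj_by G g a"
    using assms by (simp add: commutator_def conj_by_def m_assoc)
  also have "\<dots> = conj_by G g a \<otimes> inv a"
    using assms by (intro abelian) (auto intro: conj_by_A)
  finally show ?thesis .
qed

text \<open>The relation \<open>u(\<eta> - \<zeta>) = v(\<xi>\<zeta> - 1)\<close> in multiplicative notation. It compares the conjugates of \<open>c\<close>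
  by \<open>xy\<close> and by \<open>yxc\<close>, which are the same element of \<open>G\<close>.\<close>
lemma u_v_relation:
  "conj_by G y u \<otimes> inv (conj_by G c u) \<otimes> inv (conj_by G x (conj_by G c v) \<otimes> inv v) = \<one>"
proof -
  define p q r where pqr: "p = conj_by G y u" "q = conj_by G c u" "r = conj_by G x (conj_by G c v)"
  have A: "p \<in> A" "q \<in> A" "r \<in> A"
    by (simp_all add: pqr conj_by_A)
  have "v \<otimes> p = q \<otimes> conj_by G c (conj_by G x v)"
    unfolding pqr u_def v_def c_def conj_by_def commutator_def by (simp add: word_simps)
  then have vp: "v \<otimes> p = q \<otimes> r"
    by (simp add: pqr conj_c_commute)
  interpret A: normal A G
    by (rule normal)
  have [simp]: "p \<in> carrier G" "q \<in> carrier G" "r \<in> carrier G" "v \<in> carrier G"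
    using A by (simp_all add: A_carrier)
  have "p \<otimes> inv q \<otimes> inv (r \<otimes> inv v) = (p \<otimes> inv q) \<otimes> v \<otimes> inv r"
    by (simp add: word_simps)
  also have "(p \<otimes> inv q) \<otimes> v = v \<otimes> (p \<otimes> inv q)"
    using A by (intro abelian) auto
  also have "v \<otimes> (p \<otimes> inv q) \<otimes> inv r = (v \<otimes> p) \<otimes> inv q \<otimes> inv r"
    by (simp add: m_assoc)
  also have "v \<otimes> p = r \<otimes> q"
    using vp abelian A by metis
  also have "r \<otimes> q \<otimes> inv q \<otimes> inv r = \<one>"
    by (simp add: word_simps)
  finally have "p \<otimes> inv q \<otimes> inv (r \<otimes> inv v) = \<one>" .
  then show ?thesis
    by (simp add: pqr)
qed

lemma iter_commutator_A: "a \<in> A \<Longrightarrow> g \<in> carrier G \<Longrightarrow> iter_commutator G a n g \<in> A"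
proof (induction n)
  case (Suc n)
  interpret A: normal A G
    by (rule normal)
  show ?case
    using Suc by (simp add: commutator_conj conj_by_A)
qed simp

lemma v_engel:
  assumes "iter_commutator G x n y = \<one>"
  shows "iter_commutator G v n y = \<one>"
proof -
  have "iter_commutator G v n y = iter_commutator G x (2 + n) y"
    unfolding iter_commutator_add[of G x 2] by (simp add: numeral_2_eq_2 v_def c_def)
  also have "\<dots> = iter_commutator G \<one> 2 y"
    using assms by (metis add.commute iter_commutator_add)
  finally show ?thesis
    by (simp add: iter_commutator_one)
qed

text \<open>The Engel condition for \<open>y\<close> concerns \<open>[c\<inverse>, x]\<close>, since \<open>[y, x] = c\<inverse>\<close>. This is, up to inversion,
  a conjugate of \<open>u\<close> by a power of \<open>c\<close>, and conjugation by \<open>c\<close> commutes with \<open>a \<mapsto> [a, x]\<close> on \<open>A\<close>.\<close>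
lemma u_engel:
  assumes "iter_commutator G y n x = \<one>"
  shows "iter_commutator G u n x = \<one>"
proof -
  let ?u' = "commutator G (inv c) x"
  have u': "?u' \<in> A" 
    using class2[of y x x] by (simp add: c_def commutator_def word_simps)
  have yx: "commutator G y x = inv c"
    by (simp add: c_def commutator_def word_simps)
  have "iter_commutator G ?u' n x = iter_commutator G y (2 + n) x"
    unfolding iter_commutator_add[of G y 2] by (simp add: numeral_2_eq_2 yx)
  also have "\<dots> = iter_commutator G \<one> 2 x"
    using assms by (metis add.commute iter_commutator_add)
  finally have 1: "iter_commutator G ?u' n x = \<one>"
    by (simp add: iter_commutator_one)
  have "iter_commutator G (inv (conj_by G c a)) k x = inv (conj_by G c (iter_commutator G a k x))" if "a \<in> A" for a k
  proof (induction k)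
    case (Suc k)
    define b where "b = iter_commutator G a k x"
    have b: "b \<in> A"
      using that by (simp add: b_def iter_commutator_A)
    have "commutator G (inv (conj_by G c b)) x = inv (conj_by G c (commutator G b x))"
    proof -
      interpret A: normal A G
        by (rule normal)
      show ?thesis
        using b by (simp add: commutator_conj conj_by_A conj_by_mult conj_by_inv A_carrier conj_c_commute inv_mult_group abelian)
    qed
    then show ?case
      using Suc by (simp add: b_def)
  qed simp
  moreover have "u = inv (conj_by G c ?u')"
    by (simp add: u_def conj_by_def commutator_def word_simps)
  ultimately show ?thesis
    using 1 u' by (simp add: conj_by_one)
qed

text \<open>Closed under conjugation by \<open>x\<close>, \<open>y\<close>, \<open>c\<close> but possibly not by their inverses, which enter
  only through the injectivity of the operators on an isolated quotient.\<close>
definition B where "B = conj_span G {u, v} {x, y, c}"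

lemma B_subset_A: "B \<subseteq> A"
proof
  fix b assume "b \<in> B"
  interpret A: normal A G by (rule normal)
  from \<open>b \<in> B\<close>[unfolded B_def] show "b \<in> A"
    by induction (auto intro: conj_by_A)
qed

lemma B_carrier: "b \<in> B \<Longrightarrow> b \<in> carrier G"
  using A_carrier B_subset_A by blast

lemma B_subgroup: "subgroup B G"
  by (rule subgroupI) (use B_carrier in \<open>auto simp: B_def intro: conj_span.intros\<close>)

lemma B_conj: "b \<in> B \<Longrightarrow> g \<in> {x, y, c} \<Longrightarrow> conj_by G g b \<in> B"
  by (simp add: B_def conj_span.conj)

text \<open>The module \<open>B\<close> is presented as a quotient of the free abelian group on all elements of \<open>G\<close>, whose
  elements form a type, and the operators are lifted to this group. The operators
  send basis elements outside \<open>B\<close> to 0, which keeps the commutation rules exact on the whole group, and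
  the evaluation map to \<open>B\<close> sends them to \<open>\<one>\<close>, which keeps it equivariant.\<close>
definition act :: "'a \<Rightarrow> ('a \<Rightarrow>\<^sub>0 int) \<Rightarrow> ('a \<Rightarrow>\<^sub>0 int)" where
  "act g = frag_extend (\<lambda>b. if b \<in> B then frag_of (conj_by G g b) else 0)"

lemma act_diff: "act g (w - w') = act g w - act g w'"
  by (simp add: act_def frag_extend_diff)

lemma act_0: "act g 0 = 0"
  by (simp add: act_def)

lemma act_frag_of: "act g (frag_of b) = (if b \<in> B then frag_of (conj_by G g b) else 0)"
  by (simp add: act_def)

lemma frag_induct [case_names zero one diff]:
  assumes "P 0" "\<And>b. P (frag_of b)" "\<And>w w'. P w \<Longrightarrow> P w' \<Longrightarrow> P (w - w')"
  shows "P w"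
  using frag_induction[of w UNIV P] assms by simp

lemma frag_eqI:
  assumes "\<And>w w'. f (w - w') = f w - f w'" "\<And>w w'. g (w - w') = g w - g w'"
    and "\<And>b. f (frag_of b) = g (frag_of b)"
  shows "f w = (g w :: 'c::ab_group_add)"
proof (induction w rule: frag_induct)
  case zero
  then show ?case
    using assms(1)[of 0 0] assms(2)[of 0 0] by simp
qed (simp_all add: assms)

sublocale heisenberg_action "act x" "act y" "act c"
proof
  show "act c (act x w) = act x (act c w)" for w
    by (rule frag_eqI[where w = w])
      (simp_all add: act_diff act_frag_of B_conj act_0 conj_c_commute subsetD[OF B_subset_A])
  show "act c (act y w) = act y (act c w)" for w
    by (rule frag_eqI[where w = w])
      (simp_all add: act_diff act_frag_of B_conj act_0 conj_c_commute subsetD[OF B_subset_A])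
  show "act y (act x w) = act c (act x (act y w))" for w
    by (rule frag_eqI[where w = w])
      (simp_all add: act_diff act_frag_of B_conj act_0 conj_x_y subsetD[OF B_subset_A])
qed (simp_all add: act_diff)

lemma evaluation_exists:
  obtains h :: "('a \<Rightarrow>\<^sub>0 int) \<Rightarrow> 'a"
  where "\<And>w w'. h (w - w') = h w \<otimes> inv (h w')" "\<And>w. h w \<in> B"
    "\<And>b. h (frag_of b) = (if b \<in> B then b else \<one>)"
proof -
  let ?B = "G\<lparr>carrier := B\<rparr>"
  have "group ?B"
    using B_subgroup subgroup.subgroup_is_group by blast
  then interpret B: comm_group ?B
    by (rule group.group_comm_groupI) (use abelian B_subset_A in auto)
  have "(\<lambda>b. if b \<in> B then b else \<one>) ` UNIV \<subseteq> carrier ?B"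
    using subgroup.one_closed[OF B_subgroup] by auto
  then obtain h where hom: "h \<in> hom (free_Abelian_group UNIV) ?B"
    and h: "\<And>b. h (frag_of b) = (if b \<in> B then b else \<one>)"
    using B.free_Abelian_group_universal[of "\<lambda>b. if b \<in> B then b else \<one>" UNIV] by auto
  have in_B: "h w \<in> B" for w
    using hom by (auto simp: hom_def)
  have mult: "h (w + w') = h w \<otimes> h w'" for w w'
    using hom by (auto simp: hom_def)
  have "h (w - w') = h w \<otimes> inv (h w')" for w w'
    using mult[of "w - w'" w'] in_B B_carrier by (simp add: inv_solve_right)
  then show ?thesis
    by (rule that[OF _ in_B h])
qed

text \<open>The abstract theorem is applied with \<open>K\<^sub>0\<close> the set of formal sums whose value in \<open>B\<close> is
  hypercentral. Its quotient has no nonzero fixed vectors because centrality modulo a term of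
  the upper central series can be tested on \<open>x\<close> and \<open>y\<close>.\<close>
theorem nilpotent:
  assumes "mutually_engel G x y"
  shows "nilpotent_group G"
proof -
  obtain h :: "('a \<Rightarrow>\<^sub>0 int) \<Rightarrow> 'a"
    where h_diff: "\<And>w w'. h (w - w') = h w \<otimes> inv (h w')" and h_B: "\<And>w. h w \<in> B"
      and h_frag: "\<And>b. h (frag_of b) = (if b \<in> B then b else \<one>)"
    by (rule evaluation_exists, rule that)
  have h_A [simp]: "h w \<in> A" and h_carrier [simp]: "h w \<in> carrier G" for w
    using h_B B_subset_A B_carrier by blast+
  have h_0: "h 0 = \<one>"
    using h_diff[of 0 0] by simp
  have h_act: "h (act g w) = conj_by G g (h w)" if g: "g \<in> {x, y, c}" for g w
  proof -
    have [simp]: "g \<in> carrier G"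
      using g by auto
    show ?thesis
    proof (induction w rule: frag_induct)
      case (one b)
      then show ?case
        using g by (simp add: act_frag_of h_frag B_conj conj_by_one h_0)
    qed (simp_all add: act_0 h_0 conj_by_one act_diff h_diff conj_by_mult conj_by_inv)
  qed
  have h_commutator: "h (act g w - w) = commutator G (h w) g" if "g \<in> {x, y, c}" for g w
  proof -
    have "g \<in> carrier G"
      using that by auto
    then show ?thesis
      using that by (simp add: h_diff h_act commutator_conj)
  qed
  have h_iter: "h (((\<lambda>w. act g w - w) ^^ n) w) = iter_commutator G (h w) n g" if "g \<in> {x, y, c}" for g n w
    by (induction n) (simp_all add: h_commutator[OF that])
  have h_u: "h (frag_of u) = u" and h_v: "h (frag_of v) = v"
    by (simp_all add: h_frag B_def conj_span.base)
  interpret H: subgroup "hypercenter G" G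
    by (rule hypercenter_subgroup)
  let ?K = "{w. h w \<in> hypercenter G}"
  have hyper: "a \<in> hypercenter G"
    if "a \<in> carrier G" "commutator G a x \<in> hypercenter G" "commutator G a y \<in> hypercenter G" for a
    by (rule hypercenter_generators[OF _ _ generated]) (use that in auto)
  have conj_hyper: "conj_by G g a \<in> hypercenter G \<longleftrightarrow> a \<in> hypercenter G"
    if "g \<in> carrier G" "a \<in> carrier G" for a g
    using that by (simp add: conj_by_def hypercenter_conj)
  have "isolated ?K"
    unfolding isolated_def
  proof (intro conjI ballI allI impI)
    fix w assume "act x w - w \<in> ?K" "act y w - w \<in> ?K"
    then show "w \<in> ?K"
      using hyper[of "h w"] by (simp add: h_commutator)
  qed (simp_all add: h_0 h_diff h_act conj_hyper)
  moreover have "K = UNIV" if K: "isolated K" "?K \<subseteq> K" "frag_of u \<in> K" "frag_of v \<in> K" for K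
  proof -
    \<comment> \<open>The kernel of the evaluation map is contained in \<open>K\<close>.\<close>
    have ker: "w \<in> K \<longleftrightarrow> w' \<in> K" if "h w = h w'" for w w'
    proof -
      have "w - w' \<in> ?K" "w' - w \<in> ?K"
        using that by (simp_all add: h_diff)
      then have "w - w' \<in> K" "w' - w \<in> K"
        using K(2) by blast+
      then show ?thesis
        using isolated_diff[OF K(1), of w "w - w'"] isolated_diff[OF K(1), of w' "w' - w"] by auto
    qed
    have "w \<in> K" if "b \<in> B" "h w = b" for w b
      using that(1)[unfolded B_def] that(2)
    proof (induction b arbitrary: w)
      case (base s)
      then show ?case
        using ker[of w "frag_of s"] h_u h_v K(3,4) by auto
    next
      case one
      then show ?case
        using ker[of w 0] isolated_zero[OF K(1)] h_0 by simp
    next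
      case (mult a b)
      have ab: "a \<in> B" "b \<in> B"
        using mult by (simp_all add: B_def)
      have "frag_of a \<in> K" "frag_of b \<in> K"
        using ab mult.IH by (simp_all add: h_frag)
      then have "frag_of a - (0 - frag_of b) \<in> K"
        using isolated_diff isolated_zero K(1) by blast
      moreover have "h (frag_of a - (0 - frag_of b)) = a \<otimes> b"
        unfolding h_diff h_frag h_0 using ab B_carrier by simp
      ultimately show ?case
        using mult.prems ker by metis
    next
      case (inv a)
      have a: "a \<in> B"
        using inv by (simp add: B_def)
      then have "frag_of a \<in> K"
        using inv.IH by (simp add: h_frag)
      then have "0 - frag_of a \<in> K"
        using isolated_diff isolated_zero K(1) by blast
      moreover have "h (0 - frag_of a) = inv a"
        unfolding h_diff h_frag h_0 using a B_carrier by simp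
      ultimately show ?case
        using inv.prems ker by metis
    next
      case (conj a t)
      have a: "a \<in> B"
        using conj by (simp add: B_def)
      then have "frag_of a \<in> K"
        using conj.IH by (simp add: h_frag)
      then have "act t (frag_of a) \<in> K"
        using conj.hyps isolated_xi[OF K(1)] isolated_eta[OF K(1)] isolated_zeta[OF K(1)] by auto
      then show ?case
        using conj.prems ker[of w "act t (frag_of a)"] a conj.hyps h_frag h_act by simp
    qed
    then show ?thesis
      using h_B by blast
  qed
  moreover obtain n m where nm: "iter_commutator G x n y = \<one>" "iter_commutator G y m x = \<one>"
    using assms by (auto simp: mutually_engel_def)
  have "((\<lambda>w. act x w - w) ^^ m) (frag_of u) \<in> ?K" "((\<lambda>w. act y w - w) ^^ n) (frag_of v) \<in> ?K"
    using u_engel[OF nm(2)] v_engel[OF nm(1)] by (simp_all add: h_iter h_u h_v)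
  moreover have "act y (frag_of u) - act c (frag_of u) - (act x (act c (frag_of v)) - frag_of v) \<in> ?K"
    by (simp add: h_diff h_act h_u h_v u_v_relation)
  ultimately have "frag_of u \<in> ?K \<and> frag_of v \<in> ?K"
    by (rule engel_generators_mem)
  then have "c \<in> hypercenter G"
    using hyper[of c] by (simp add: h_u h_v flip: u_def v_def)
  moreover have "commutator G x x = \<one>" "commutator G y y = \<one>" "commutator G y x = inv c"
    by (simp_all add: c_def commutator_def word_simps)
  ultimately have "x \<in> hypercenter G" "y \<in> hypercenter G"
    using hyper[of x] hyper[of y] by (simp_all add: c_def)
  then show ?thesis
    by (intro nilpotent_if_generators_hypercentral[of "{x, y}"] generated) auto
qed

end

theorem theorem3p5:
  fixes G :: "('a, 'b) monoid_scheme" and x y :: 'a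
  assumes "group G"
    and "abelian_by_nilpotent2 G"
    and "x \<in> carrier G" and "y \<in> carrier G"
    and "generate G {x, y} = carrier G"
    and "mutually_engel G x y"
  shows "nilpotent_group G"
proof -
  interpret group G by fact
  obtain A where A: "A \<lhd> G" "comm_group (G\<lparr>carrier := A\<rparr>)" "nilpotent_class_le 2 (G Mod A)"
    using assms(2) by (auto simp: abelian_by_nilpotent2_def)
  have "a \<otimes>\<^bsub>G\<^esub> b = b \<otimes>\<^bsub>G\<^esub> a" if "a \<in> A" "b \<in> A" for a b
    using comm_monoid.m_comm[OF comm_group.axioms(1)[OF A(2)], of a b] that by simp
  then interpret two_generator_abelian_by_class2 G A x y
    using A triple_commutator_mem assms
    by (intro two_generator_abelian_by_class2.intro two_generator_abelian_by_class2_axioms.intro) simp_all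
  show ?thesis
    using assms(6) by (rule nilpotent)
qed

end
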